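(* For any count-based test statistic $T$ and any $\mathbf{r}\in\{1,\dots,J\}^N$, the following holds. (i) The worst-case null distribution satisfies $\alpha(T,\mathbf{r},\mathbf{u}^+)=\max_{\mathbf{u}\in\{0,1\}^N}\alpha(T,\mathbf{r},\mathbf{u})$. (ii) If $\mathbf{u},\mathbf{u}'\in\{0,1\}^N$ satisfy $\mathbf{u}\sim\mathbf{u}'$, then $\alpha(T,\mathbf{r},\mathbf{u})=\alpha(T,\mathbf{r},\mathbf{u}')$. (iii) Let $\tilde\alpha(T,\mathbf{r},[\mathbf{u}]):=\alpha(T,\mathbf{r},\mathbf{u}')$ for any $\mathbf{u}'\in[\mathbf{u}]$. Then $\alpha(T,\mathbf{r},\mathbf{u}^+)=\max_{[\mathbf{u}]\in\mathcal{U}_{\rm C}}\tilde\alpha(T,\mathbf{r},[\mathbf{u}])$. (iv) The size of the set of equivalence classes (the candidate set) satisfies $|\mathcal{U}_{\rm C}|\le N^J$.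
   Context: There are $N$ subjects, $I$ treatment levels and $J$ outcome levels, and positive integers $N_{1\cdot},\dots,N_{I\cdot}$ with $\sum_i N_{i\cdot}=N$. Let $\mathcal{Z}(\mathbf{N}_{I\cdot})=\{\mathbf{z}\in\{1,\dots,I\}^N:\ |\{s:z_s=i\}|=N_{i\cdot}\ \forall i\}$. The outcome vector $\mathbf{r}\in\{1,\dots,J\}^N$ is fixed (sharp null hypothesis of no treatment effect). For $\mathbf{z}\in\mathcal{Z}(\mathbf{N}_{I\cdot})$, $\mathbf{N}(\mathbf{z},\mathbf{r})$ is the $I\times J$ table with entries $N_{ij}=\sum_{s=1}^N\mathbb{1}\{z_s=i,r_s=j\}$. A test statistic is count-based if it is a real-valued function $T(\mathbf{N}(\mathbf{z},\mathbf{r}))$ of this table only. For $\mathbf{u}\in[0,1]^N$ (unmeasured confounder), sensitivity parameters $\gamma\ge0$ and $\boldsymbol\delta=(\delta_1,\dots,\delta_I)\in\{0,1\}^I$ (not all entries equal), and threshold $c\in\mathbb{R}$, the null distribution is $$\alpha(T,\mathbf{r},\mathbf{u})=\frac{\sum_{\mathbf{z}\in\mathcal{Z}(\mathbf{N}_{I\cdot})}\mathbb{1}\{T(\mathbf{N}(\mathbf{z},\mathbf{r}))\ge c\}\exp\{\gamma\sum_{s=1}^N\delta_{z_s}u_s\}}{\sum_{\mathbf{b}\in\mathcal{Z}(\mathbf{N}_{I\cdot})}\exp\{\gamma\sum_{s=1}^N\delta_{b_s}u_s\}}.$$ The worst-case unmeasured confounder is $\mathbf{u}^+=\operatorname{argmax}_{\mathbf{u}\in[0,1]^N}\alpha(T,\mathbf{r},\mathbf{u})$,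 and the worst-case null distribution is $\alpha(T,\mathbf{r},\mathbf{u}^+)=\max_{\mathbf{u}\in[0,1]^N}\alpha(T,\mathbf{r},\mathbf{u})$. For $\mathbf{u}\in\{0,1\}^N$ let $\overline{\mathbf{u}}=(\overline u_1,\dots,\overline u_J)$ with $\overline u_j=\sum_{s=1}^N\mathbb{1}\{r_s=j,u_s=1\}$. Define $\mathbf{u}\sim\mathbf{u}'$ if and only if $\overline{\mathbf{u}}=\overline{\mathbf{u}}'$; $[\mathbf{u}]$ is the equivalence class of $\mathbf{u}$ in $\{0,1\}^N$, and $\mathcal{U}_{\rm C}=\{0,1\}^N/\!\sim$ is the set of all equivalence classes.
   Formalization: Part (iv) is stated only for J ≥ 2 outcome levels: for J = 1 there are N+1 equivalence classes, so the bound |U_C| ≤ N^J = N always fails (e.g. N = 2, J = 1 gives 3 classes). *)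

theory Defs
  imports Complex_Main "HOL-Library.FuncSet"
begin

text \<open>
  Subjects, treatment levels and outcome levels are \<open>{1..N}\<close>, \<open>{1..I}\<close> and \<open>{1..J}\<close>; a vector
  in \<open>A\<close> to the power \<open>N\<close> is an element of \<open>{1..N} \<rightarrow>\<^sub>E A\<close>. Extensionality (the value
  \<open>undefined\<close> off \<open>{1..N}\<close>) makes distinct functions distinct vectors, so that sums over and
  cardinalities of such sets are the intended ones.
\<close>

definition assignments :: "nat \<Rightarrow> nat \<Rightarrow> (nat \<Rightarrow> nat) \<Rightarrow> (nat \<Rightarrow> nat) set" where
  "assignments N I n =
     {z \<in> {1..N} \<rightarrow>\<^sub>E {1..I}. \<forall>i\<in>{1..I}. card {s \<in> {1..N}. z s = i} = n i}"

text \<open>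
  The entries outside \<open>{1..I} \<times> {1..J}\<close> vanish for all treatment and outcome vectors with
  those levels, so an arbitrary \<open>T :: (nat \<Rightarrow> nat \<Rightarrow> nat) \<Rightarrow> real\<close> applied to this
  function is an arbitrary real function of the \<open>I \<times> J\<close> table.
\<close>

definition count_table :: "nat \<Rightarrow> (nat \<Rightarrow> nat) \<Rightarrow> (nat \<Rightarrow> nat) \<Rightarrow> nat \<Rightarrow> nat \<Rightarrow> nat" where
  "count_table N z r = (\<lambda>i j. \<Sum>s\<in>{1..N}. of_bool (z s = i \<and> r s = j))"

definition null_dist ::
  "nat \<Rightarrow> nat \<Rightarrow> (nat \<Rightarrow> nat) \<Rightarrow> real \<Rightarrow> (nat \<Rightarrow> real) \<Rightarrow> real \<Rightarrow>
   ((nat \<Rightarrow> nat \<Rightarrow> nat) \<Rightarrow> real) \<Rightarrow> (nat \<Rightarrow> nat) \<Rightarrow> (nat \<Rightarrow> real) \<Rightarrow> real" where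
  "null_dist N I n \<gamma> \<delta> c T r u =
     (\<Sum>z\<in>assignments N I n.
        of_bool (T (count_table N z r) \<ge> c) * exp (\<gamma> * (\<Sum>s\<in>{1..N}. \<delta> (z s) * u s))) /
     (\<Sum>b\<in>assignments N I n. exp (\<gamma> * (\<Sum>s\<in>{1..N}. \<delta> (b s) * u s)))"

definition confounders :: "nat \<Rightarrow> (nat \<Rightarrow> real) set" where
  "confounders N = {1..N} \<rightarrow>\<^sub>E {0..1}"

definition binary_confounders :: "nat \<Rightarrow> (nat \<Rightarrow> real) set" where
  "binary_confounders N = {1..N} \<rightarrow>\<^sub>E {0, 1}"

definition worst_case_confounder ::
  "nat \<Rightarrow> nat \<Rightarrow> (nat \<Rightarrow> nat) \<Rightarrow> real \<Rightarrow> (nat \<Rightarrow> real) \<Rightarrow> real \<Rightarrow>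
   ((nat \<Rightarrow> nat \<Rightarrow> nat) \<Rightarrow> real) \<Rightarrow> (nat \<Rightarrow> nat) \<Rightarrow> (nat \<Rightarrow> real) \<Rightarrow> bool" where
  "worst_case_confounder N I n \<gamma> \<delta> c T r u \<longleftrightarrow>
     is_arg_max (null_dist N I n \<gamma> \<delta> c T r) (\<lambda>v. v \<in> confounders N) u"

definition level_counts :: "nat \<Rightarrow> nat \<Rightarrow> (nat \<Rightarrow> nat) \<Rightarrow> (nat \<Rightarrow> real) \<Rightarrow> nat \<Rightarrow> nat" where
  "level_counts N J r u = (\<lambda>j\<in>{1..J}. \<Sum>s\<in>{1..N}. of_bool (r s = j \<and> u s = 1))"

definition confounder_equiv ::
  "nat \<Rightarrow> nat \<Rightarrow> (nat \<Rightarrow> nat) \<Rightarrow> ((nat \<Rightarrow> real) \<times> (nat \<Rightarrow> real)) set" where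
  "confounder_equiv N J r =
     {(u, u'). u \<in> binary_confounders N \<and> u' \<in> binary_confounders N \<and>
        level_counts N J r u = level_counts N J r u'}"

definition candidate_set :: "nat \<Rightarrow> nat \<Rightarrow> (nat \<Rightarrow> nat) \<Rightarrow> (nat \<Rightarrow> real) set set" where
  "candidate_set N J r = binary_confounders N // confounder_equiv N J r"

text \<open>
  The common value on a class: \<^const>\<open>the_elem\<close> is meaningful only when the image is a
  singleton, that is, when \<open>null_dist\<close> is constant on the class.
\<close>

definition class_null_dist ::
  "nat \<Rightarrow> nat \<Rightarrow> (nat \<Rightarrow> nat) \<Rightarrow> real \<Rightarrow> (nat \<Rightarrow> real) \<Rightarrow> real \<Rightarrow>
   ((nat \<Rightarrow> nat \<Rightarrow> nat) \<Rightarrow> real) \<Rightarrow> (nat \<Rightarrow> nat) \<Rightarrow> (nat \<Rightarrow> real) set \<Rightarrow> real" where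
  "class_null_dist N I n \<gamma> \<delta> c T r C = the_elem (null_dist N I n \<gamma> \<delta> c T r ` C)"

end

theory Submission
  imports Defs "HOL-Combinatorics.Permutations"
begin

text \<open>
  With all coordinates of \<open>u\<close> but the \<open>s\<close>-th fixed, the null distribution is a linear fractional
  function of \<open>exp (\<gamma> * u s)\<close>, because \<open>\<delta>\<close> takes the values 0 and 1 only. Such a function is
  monotone, so moving \<open>u s\<close> to one of the endpoints 0 and 1 does not decrease it, and doing this
  for every coordinate reaches a binary confounder. Two equivalent binary confounders differ by a
  permutation of the subjects that preserves \<open>r\<close>; reindexing the assignments by this
  permutation leaves the count tables unchanged. Finally, a class is determined by
  its level counts, the \<open>j\<close>-th of which ranges over \<open>0..m j\<close>, where \<open>m j\<close> is the number of
  subjects with outcome \<open>j\<close>, and the product of the \<open>m j + 1\<close> is at most \<open>N ^ J\<close>.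
\<close>

section \<open>Reduction from the cube to its vertices\<close>

text \<open>The difference of the values at \<open>w\<close> and \<open>y\<close> has the sign of
  \<open>(B * C - A * D) * (w - y)\<close>, so the sign of the determinant decides which endpoint
  wins.\<close>

lemma linear_fractional_le_endpoint:
  fixes A B C D x y z :: real
  assumes "0 \<le> C" "0 \<le> D" "0 < x" "x \<le> y" "y \<le> z"
  shows "(A + B * y) / (C + D * y) \<le> (A + B * x) / (C + D * x) \<or>
         (A + B * y) / (C + D * y) \<le> (A + B * z) / (C + D * z)"
\<comment> \<open>If both coefficients vanish, every quotient is 0 by the convention for division by
  zero. This covers an empty set of assignments.\<close>
proof (cases "C = 0 \<and> D = 0")
  case False
  have pos: "C + D * w > 0" if "w > 0" for w
    using False assms(1,2) that
    by (metis add_nonneg_pos add_pos_nonneg less_eq_real_def mult_nonneg_nonneg mult_pos_pos)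
  have diff: "(A + B * w) / (C + D * w) - (A + B * y) / (C + D * y) =
      (B * C - A * D) * (w - y) / ((C + D * w) * (C + D * y))" if "w > 0" for w
    using pos[OF that] pos[of y] assms by (simp add: diff_frac_eq) (simp add: algebra_simps)
  show ?thesis
  proof (cases "B * C - A * D \<ge> 0")
    case True
    then have "0 \<le> (B * C - A * D) * (z - y) / ((C + D * z) * (C + D * y))"
      using assms pos[of z] pos[of y] by simp
    then show ?thesis using diff[of z] assms by linarith
  next
    case False
    then have "0 \<le> (B * C - A * D) * (x - y) / ((C + D * x) * (C + D * y))"
      using assms pos[of x] pos[of y] by (simp add: mult_nonpos_nonpos)
    then show ?thesis using diff[of x] assms by linarith
  qed
qed simp

lemma finite_assignments: "finite (assignments N I n)"
  unfolding assignments_def by (rule finite_subset[of _ "{1..N} \<rightarrow>\<^sub>E {1..I}"]) (auto simp: finite_PiE)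

lemma null_dist_update_le_endpoint:
  assumes \<gamma>: "\<gamma> \<ge> 0" and \<delta>: "\<forall>i\<in>{1..I}. \<delta> i \<in> {0, 1}"
    and s: "s \<in> {1..N}" and us: "u s \<in> {0..1}"
  shows "null_dist N I n \<gamma> \<delta> c T r u \<le> null_dist N I n \<gamma> \<delta> c T r (u(s := 0)) \<or>
         null_dist N I n \<gamma> \<delta> c T r u \<le> null_dist N I n \<gamma> \<delta> c T r (u(s := 1))"
proof -
  \<comment> \<open>\<open>W z\<close> is the part of the weight that is independent of coordinate
    \<open>s\<close>; \<open>S h d\<close> collects the assignments with
    \<open>\<delta> (z s) = d\<close>. They supply the coefficients of the linear fractional
    function: \<open>h = g\<close> gives the numerator, \<open>h = 1\<close> the
    denominator.\<close>
  define W where "W z = exp (\<gamma> * (\<Sum>k\<in>{1..N} - {s}. \<delta> (z k) * u k))" for z :: "nat \<Rightarrow> nat"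
  define S where "S h d = (\<Sum>z\<in>assignments N I n. h z * W z * of_bool (\<delta> (z s) = d))"
    for h :: "(nat \<Rightarrow> nat) \<Rightarrow> real" and d
  have weight: "exp (\<gamma> * (\<Sum>k\<in>{1..N}. \<delta> (z k) * (u(s := t)) k)) =
      W z * (of_bool (\<delta> (z s) = 0) + of_bool (\<delta> (z s) = 1) * exp (\<gamma> * t))"
    if z: "z \<in> assignments N I n" for z t
  proof -
    have "\<delta> (z s) \<in> {0, 1}" using z s \<delta> by (auto simp: assignments_def PiE_iff)
    moreover have "(\<Sum>k\<in>{1..N}. \<delta> (z k) * (u(s := t)) k) =
        \<delta> (z s) * t + (\<Sum>k\<in>{1..N} - {s}. \<delta> (z k) * u k)"
      by (subst sum.remove[OF _ s]) (auto intro!: sum.cong)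
    ultimately show ?thesis by (auto simp: W_def ring_distribs exp_add)
  qed
  have total: "(\<Sum>z\<in>assignments N I n. h z * exp (\<gamma> * (\<Sum>k\<in>{1..N}. \<delta> (z k) * (u(s := t)) k))) =
      S h 0 + S h 1 * exp (\<gamma> * t)" for h t
    unfolding S_def sum_distrib_right sum.distrib[symmetric]
    by (rule sum.cong) (auto simp only: weight ring_distribs mult_ac)
  define g where "g z = (of_bool (T (count_table N z r) \<ge> c) :: real)" for z
  have frac: "null_dist N I n \<gamma> \<delta> c T r (u(s := t)) =
      (S g 0 + S g 1 * exp (\<gamma> * t)) / (S (\<lambda>_. 1) 0 + S (\<lambda>_. 1) 1 * exp (\<gamma> * t))" for t
    using total[of g t] total[of "\<lambda>_. 1" t] by (simp only: null_dist_def g_def mult_1_left)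
  have "0 \<le> S (\<lambda>_. 1) d" for d by (auto simp: S_def W_def intro!: sum_nonneg)
  moreover have "exp (\<gamma> * 0) \<le> exp (\<gamma> * u s)" "exp (\<gamma> * u s) \<le> exp (\<gamma> * 1)"
    using \<gamma> us by (auto simp: mult_left_le)
  \<comment> \<open>The instance \<open>t = u s\<close> of \<open>frac\<close> describes
    \<open>u\<close> itself.\<close>
  ultimately show ?thesis
    using linear_fractional_le_endpoint[of "S (\<lambda>_. 1) 0" "S (\<lambda>_. 1) 1" "exp (\<gamma> * 0)" "exp (\<gamma> * u s)"
        "exp (\<gamma> * 1)" "S g 0" "S g 1"] frac[of "u s"] frac[of 0] frac[of 1]
    by simp
qed

lemma null_dist_le_binary:
  assumes "\<gamma> \<ge> 0" and "\<forall>i\<in>{1..I}. \<delta> i \<in> {0, 1}" and u: "u \<in> confounders N"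
  obtains v where "v \<in> binary_confounders N"
    and "null_dist N I n \<gamma> \<delta> c T r u \<le> null_dist N I n \<gamma> \<delta> c T r v"
proof -
  let ?f = "null_dist N I n \<gamma> \<delta> c T r"
  \<comment> \<open>\<open>S\<close> is the set of coordinates already made binary; updating a
    further coordinate leaves these alone.\<close>
  have "\<exists>v\<in>confounders N. (\<forall>s\<in>S. v s \<in> {0, 1}) \<and> ?f u \<le> ?f v" if "finite S" "S \<subseteq> {1..N}" for S
    using that
  proof (induction S rule: finite_induct)
    case empty
    then show ?case using u by auto
  next
    case (insert s S)
    then obtain v where v: "v \<in> confounders N" "\<forall>k\<in>S. v k \<in> {0, 1}" "?f u \<le> ?f v" by auto
    have s: "s \<in> {1..N}" using insert.prems by auto
    then have "v s \<in> {0..1}" using v(1) by (auto simp: confounders_def PiE_iff)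
    then obtain t :: real where t: "t \<in> {0, 1}" "?f v \<le> ?f (v(s := t))"
      using null_dist_update_le_endpoint[OF assms(1,2) s] by blast
    moreover have "v(s := t) \<in> confounders N"
      using v(1) s t(1) by (auto simp: confounders_def PiE_iff extensional_def)
    moreover have "\<forall>k\<in>insert s S. (v(s := t)) k \<in> {0, 1}" using v(2) t(1) by auto
    ultimately show ?case using order_trans[OF v(3) t(2)] by blast
  qed
  from this[of "{1..N}"] obtain v where "v \<in> confounders N" "\<forall>s\<in>{1..N}. v s \<in> {0, 1}" "?f u \<le> ?f v"
    by auto
  then show ?thesis using that[of v] by (auto simp: confounders_def binary_confounders_def PiE_iff)
qed

lemma finite_binary_confounders: "finite (binary_confounders N)"
  by (simp add: binary_confounders_def finite_PiE)

lemma binary_confounders_nonempty: "binary_confounders N \<noteq> {}"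
  by (simp add: binary_confounders_def PiE_eq_empty_iff)

lemma binary_confounders_subset: "binary_confounders N \<subseteq> confounders N"
  unfolding confounders_def binary_confounders_def by (rule PiE_mono) auto

text \<open>The finite maximum over the vertices bounds the whole cube and is attained at a vertex,
  so a maximizer is exactly a point with this value. Existence thus follows without
  compactness.\<close>

lemma worst_case_confounder_iff:
  assumes "\<gamma> \<ge> 0" and "\<forall>i\<in>{1..I}. \<delta> i \<in> {0, 1}"
  shows "worst_case_confounder N I n \<gamma> \<delta> c T r u \<longleftrightarrow> u \<in> confounders N \<and>
    null_dist N I n \<gamma> \<delta> c T r u = Max (null_dist N I n \<gamma> \<delta> c T r ` binary_confounders N)"
proof -
  let ?f = "null_dist N I n \<gamma> \<delta> c T r"
  let ?M = "Max (?f ` binary_confounders N)"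
  have le: "?f v \<le> ?M" if v: "v \<in> confounders N" for v
  proof -
    obtain w where "w \<in> binary_confounders N" "?f v \<le> ?f w"
      using null_dist_le_binary[OF assms v] .
    moreover from this(1) have "?f w \<le> ?M"
      by (intro Max_ge finite_imageI finite_binary_confounders imageI)
    ultimately show ?thesis by linarith
  qed
  have "?M \<in> ?f ` binary_confounders N"
    by (simp add: finite_binary_confounders binary_confounders_nonempty)
  then obtain w where "w \<in> confounders N" "?f w = ?M" using binary_confounders_subset by fastforce
  then show ?thesis
    unfolding worst_case_confounder_def is_arg_max_def
    using le by (metis (no_types, lifting) not_less order_antisym)
qed

section \<open>Invariance within equivalence classes\<close>

lemma null_dist_permute:
  assumes p: "p permutes {1..N}" and r: "\<forall>s\<in>{1..N}. r (p s) = r s"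
    and u: "\<forall>s\<in>{1..N}. u s = u' (p s)"
  shows "null_dist N I n \<gamma> \<delta> c T r u = null_dist N I n \<gamma> \<delta> c T r u'"
proof -
  let ?A = "assignments N I n"
  have sum_permute: "(\<Sum>s\<in>{1..N}. h (q s)) = (\<Sum>s\<in>{1..N}. h s)" if "q permutes {1..N}"
    for q and h :: "nat \<Rightarrow> 'b :: comm_monoid_add"
    by (rule sum.reindex_bij_betw[OF permutes_imp_bij[OF that]])
  \<comment> \<open>A permutation preserves the treatment totals, and it fixes points outside
    \<open>{1..N}\<close>, so extensionality survives.\<close>
  have comp: "z \<circ> q \<in> ?A" if z: "z \<in> ?A" and q: "q permutes {1..N}" for z q
  proof -
    have "card {s \<in> {1..N}. (z \<circ> q) s = i} = card {s \<in> {1..N}. z s = i}" for i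
      using sum_permute[OF q, of "\<lambda>s. of_bool (z s = i) :: nat"]
      by (simp add: of_bool_def sum.If_cases Int_def)
    moreover have "z \<circ> q \<in> {1..N} \<rightarrow>\<^sub>E {1..I}"
      using z permutes_in_image[OF q] permutes_not_in[OF q]
      by (auto simp: assignments_def PiE_iff extensional_def simp del: atLeastAtMost_iff)
    ultimately show ?thesis using z by (simp add: assignments_def)
  qed
  have bij: "bij_betw (\<lambda>z. z \<circ> p) ?A ?A"
    by (rule bij_betw_byWitness[where f' = "\<lambda>z. z \<circ> inv p"])
      (use comp p permutes_inv[OF p] in \<open>auto simp: comp_assoc permutes_inv_o\<close>)
  have "(\<Sum>s\<in>{1..N}. \<delta> ((z \<circ> p) s) * u s) = (\<Sum>s\<in>{1..N}. \<delta> (z s) * u' s)" for z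
    using u sum_permute[OF p, of "\<lambda>s. \<delta> (z s) * u' s"] by simp
  moreover have "count_table N (z \<circ> p) r = count_table N z r" for z
    using r sum_permute[OF p, of "\<lambda>s. of_bool (z s = i \<and> r s = j) :: nat" for i j]
    by (simp add: count_table_def)
  ultimately show ?thesis
    unfolding null_dist_def by (subst (1 2) sum.reindex_bij_betw[OF bij, symmetric]) simp
qed

lemma level_counts_eq_card:
  "j \<in> {1..J} \<Longrightarrow> level_counts N J r u j = card {s \<in> {1..N}. r s = j \<and> u s = 1}"
  by (simp add: level_counts_def of_bool_def sum.If_cases Int_def)

lemma null_dist_cong_equiv:
  assumes equiv: "(u, u') \<in> confounder_equiv N J r" and r: "r \<in> {1..N} \<rightarrow>\<^sub>E {1..J}"
  shows "null_dist N I n \<gamma> \<delta> c T r u = null_dist N I n \<gamma> \<delta> c T r u'"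
proof -
  have bin: "\<forall>s\<in>{1..N}. u s \<in> {0, 1}" "\<forall>s\<in>{1..N}. u' s \<in> {0, 1}"
    and lev: "level_counts N J r u = level_counts N J r u'"
    using equiv by (auto simp: confounder_equiv_def binary_confounders_def PiE_iff)
  have one: "card {s \<in> {1..N}. r s = j \<and> u s = 1} = card {s \<in> {1..N}. r s = j \<and> u' s = 1}"
    if "j \<in> {1..J}" for j
    using lev level_counts_eq_card[OF that] by metis
  \<comment> \<open>Level counts record only the ones; the zeros are their complement within each
    outcome level.\<close>
  have zero: "card {s \<in> {1..N}. r s = j \<and> v s = 0} =
      card {s \<in> {1..N}. r s = j} - card {s \<in> {1..N}. r s = j \<and> v s = 1}"
    if "\<forall>s\<in>{1..N}. v s \<in> {0, 1}" for v :: "nat \<Rightarrow> real" and j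
  proof -
    have "{s \<in> {1..N}. r s = j \<and> v s = 0} =
        {s \<in> {1..N}. r s = j} - {s \<in> {1..N}. r s = j \<and> v s = 1}"
      using that by force
    then show ?thesis by (simp add: card_Diff_subset Collect_mono)
  qed
  have fibre: "card {s \<in> {1..N}. (r s, u s) = a} = card {s \<in> {1..N}. (r s, u' s) = a}" for a
  proof (cases "fst a \<in> {1..J} \<and> snd a \<in> {0, 1}")
    case True
    then show ?thesis using one[of "fst a"] zero[OF bin(1), of "fst a"] zero[OF bin(2), of "fst a"]
      by (cases a) auto
  next
    case False
    then have "{s \<in> {1..N}. (r s, v s) = a} = {}" if "\<forall>s\<in>{1..N}. v s \<in> {0, 1}" for v
      using r that by (auto simp: PiE_iff)
    from this[OF bin(1)] this[OF bin(2)] show ?thesis by (simp only:)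
  qed
  \<comment> \<open>Equal fibre sizes mean equal multisets of values. Pairing \<open>u\<close> with
    \<open>r\<close> makes the resulting permutation preserve outcomes while matching
    \<open>u\<close> with \<open>u'\<close>.\<close>
  have "image_mset (\<lambda>s. (r s, u s)) (mset_set {1..N}) = image_mset (\<lambda>s. (r s, u' s)) (mset_set {1..N})"
    using fibre by (intro multiset_eqI) (simp only: count_image_mset_eq_card_vimage[OF finite_atLeastAtMost])
  then obtain p where p: "p permutes {1..N}" "\<forall>s\<in>{1..N}. (r s, u s) = (r (p s), u' (p s))"
    by (rule image_mset_eq_implies_permutes[OF finite_atLeastAtMost]) blast
  then show ?thesis by (intro null_dist_permute[OF p(1)]) auto
qed

lemma class_null_dist_eq:
  assumes "C \<in> candidate_set N J r" "u \<in> C" and r: "r \<in> {1..N} \<rightarrow>\<^sub>E {1..J}"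
  shows "class_null_dist N I n \<gamma> \<delta> c T r C = null_dist N I n \<gamma> \<delta> c T r u"
proof -
  have "(u, v) \<in> confounder_equiv N J r" if "v \<in> C" for v
    using assms(1,2) that
    by (auto simp: candidate_set_def quotient_def confounder_equiv_def)
  then have "null_dist N I n \<gamma> \<delta> c T r ` C = {null_dist N I n \<gamma> \<delta> c T r u}"
    using assms(2) null_dist_cong_equiv[OF _ r] by (metis image_constant image_cong)
  then show ?thesis by (simp add: class_null_dist_def)
qed

text \<open>Every class has a binary representative with the same value, so both maxima range over
  the same set of reals.\<close>

lemma class_null_dist_image:
  assumes "r \<in> {1..N} \<rightarrow>\<^sub>E {1..J}"
  shows "class_null_dist N I n \<gamma> \<delta> c T r ` candidate_set N J r =
         null_dist N I n \<gamma> \<delta> c T r ` binary_confounders N"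
proof -
  have "class_null_dist N I n \<gamma> \<delta> c T r (confounder_equiv N J r `` {u}) = null_dist N I n \<gamma> \<delta> c T r u"
    if "u \<in> binary_confounders N" for u
    by (rule class_null_dist_eq[OF _ _ assms])
      (use that in \<open>auto simp: candidate_set_def quotient_def confounder_equiv_def\<close>)
  moreover have "candidate_set N J r = (\<lambda>u. confounder_equiv N J r `` {u}) ` binary_confounders N"
    by (auto simp: candidate_set_def quotient_def)
  ultimately show ?thesis by (simp add: image_image)
qed

section \<open>Counting the equivalence classes\<close>

text \<open>Each factor is at most \<open>N\<close> unless some \<open>m k = N\<close>. In that case
  all other factors are 1 and the product is \<open>N + 1\<close>, which is at most
  \<open>N ^ 2\<close>.\<close>

lemma prod_Suc_le_power:
  fixes m :: "nat \<Rightarrow> nat"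
  assumes sum: "(\<Sum>j\<in>{1..J}. m j) = N" and "N \<ge> 2" "J \<ge> 2"
  shows "(\<Prod>j\<in>{1..J}. Suc (m j)) \<le> N ^ J"
proof (cases "\<exists>k\<in>{1..J}. m k = N")
  case True
  then obtain k where k: "k \<in> {1..J}" "m k = N" by blast
  then have "(\<Sum>j\<in>{1..J} - {k}. m j) = 0"
    using sum sum.remove[of "{1..J}" k m] by simp
  then have "(\<Prod>j\<in>{1..J} - {k}. Suc (m j)) = 1" by (intro prod.neutral) simp
  then have "(\<Prod>j\<in>{1..J}. Suc (m j)) = N + 1"
    using k by (simp add: prod.remove[of _ k])
  also have "\<dots> \<le> 2 * N" using \<open>N \<ge> 2\<close> by simp
  also have "\<dots> \<le> N ^ 2" using \<open>N \<ge> 2\<close> by (simp add: power2_eq_square)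
  also have "\<dots> \<le> N ^ J" using assms by (intro power_increasing) auto
  finally show ?thesis .
next
  case False
  have "m j \<le> N" if "j \<in> {1..J}" for j
    using member_le_sum[OF that, of m] sum by simp
  then have "Suc (m j) \<le> N" if "j \<in> {1..J}" for j
    using False that by (metis Suc_leI le_neq_implies_less)
  then have "(\<Prod>j\<in>{1..J}. Suc (m j)) \<le> (\<Prod>j\<in>{1..J}. N)" by (intro prod_mono) auto
  then show ?thesis by simp
qed

lemma card_candidate_set_le:
  assumes r: "r \<in> {1..N} \<rightarrow>\<^sub>E {1..J}"
  shows "card (candidate_set N J r) \<le> (\<Prod>j\<in>{1..J}. Suc (card {s \<in> {1..N}. r s = j}))"
proof -
  let ?L = "level_counts N J r" and ?B = "binary_confounders N"
  let ?P = "\<Pi>\<^sub>E j\<in>{1..J}. {..card {s \<in> {1..N}. r s = j}}"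
  have "confounder_equiv N J r `` {u} = {v \<in> ?B. ?L v = ?L u}" if "u \<in> ?B" for u
    using that by (auto simp: confounder_equiv_def)
  \<comment> \<open>The classes are the nonempty fibres of \<open>level_counts\<close>, hence no
    more numerous than its values, which lie in the box \<open>?P\<close>.\<close>
  then have "candidate_set N J r = (\<lambda>l. {v \<in> ?B. ?L v = l}) ` ?L ` ?B"
    by (auto simp: candidate_set_def quotient_def)
  then have "card (candidate_set N J r) \<le> card (?L ` ?B)"
    using finite_binary_confounders by (simp add: card_image_le)
  also have "\<dots> \<le> card ?P"
  proof (rule card_mono)
    have "card {s \<in> {1..N}. r s = j \<and> u s = 1} \<le> card {s \<in> {1..N}. r s = j}"
      for u :: "nat \<Rightarrow> real" and j
      by (rule card_mono) auto
    then have "?L u \<in> ?P" for u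
      using level_counts_eq_card[of _ J N r u]
      by (intro PiE_I) (simp_all only: atMost_iff, simp only: level_counts_def restrict_apply if_False)
    then show "?L ` ?B \<subseteq> ?P" by blast
  qed (simp add: finite_PiE)
  finally show ?thesis by (simp add: card_PiE)
qed

text \<open>Existence of a maximizer keeps the claims about all maximizers from being vacuous. The
  cardinality bound assumes \<open>J \<ge> 2\<close>, since a single outcome level gives
  \<open>N + 1\<close> classes.\<close>

theorem theorem1:
  fixes N I J :: nat
    and n :: "nat \<Rightarrow> nat"
    and \<gamma> c :: real
    and \<delta> :: "nat \<Rightarrow> real"
    and T :: "(nat \<Rightarrow> nat \<Rightarrow> nat) \<Rightarrow> real"
    and r :: "nat \<Rightarrow> nat"
  assumes "\<forall>i\<in>{1..I}. n i > 0"
    and "(\<Sum>i\<in>{1..I}. n i) = N"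
    and "\<gamma> \<ge> 0"
    and "\<forall>i\<in>{1..I}. \<delta> i \<in> {0, 1}"
    and "\<exists>i\<in>{1..I}. \<exists>i'\<in>{1..I}. \<delta> i \<noteq> \<delta> i'"
    and "r \<in> {1..N} \<rightarrow>\<^sub>E {1..J}"
  shows
    "(\<exists>up. worst_case_confounder N I n \<gamma> \<delta> c T r up) \<and>
     (\<forall>up. worst_case_confounder N I n \<gamma> \<delta> c T r up \<longrightarrow>
        null_dist N I n \<gamma> \<delta> c T r up =
          Max (null_dist N I n \<gamma> \<delta> c T r ` binary_confounders N)) \<and>
     (\<forall>u\<in>binary_confounders N. \<forall>u'\<in>binary_confounders N.
        (u, u') \<in> confounder_equiv N J r \<longrightarrow>
        null_dist N I n \<gamma> \<delta> c T r u = null_dist N I n \<gamma> \<delta> c T r u') \<and>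
     (\<forall>C\<in>candidate_set N J r. \<forall>u'\<in>C.
        class_null_dist N I n \<gamma> \<delta> c T r C = null_dist N I n \<gamma> \<delta> c T r u') \<and>
     (\<forall>up. worst_case_confounder N I n \<gamma> \<delta> c T r up \<longrightarrow>
        null_dist N I n \<gamma> \<delta> c T r up =
          Max (class_null_dist N I n \<gamma> \<delta> c T r ` candidate_set N J r)) \<and>
     (J \<ge> 2 \<longrightarrow> card (candidate_set N J r) \<le> N ^ J)"
proof (intro conjI allI ballI impI)
  note \<gamma>\<delta> = assms(3,4) and r = assms(6)
  let ?f = "null_dist N I n \<gamma> \<delta> c T r"
  have "Max (?f ` binary_confounders N) \<in> ?f ` binary_confounders N"
    by (simp add: finite_binary_confounders binary_confounders_nonempty)
  then show "\<exists>up. worst_case_confounder N I n \<gamma> \<delta> c T r up"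
    using worst_case_confounder_iff[OF \<gamma>\<delta>] binary_confounders_subset by fastforce
  show "?f up = Max (?f ` binary_confounders N)"
    if "worst_case_confounder N I n \<gamma> \<delta> c T r up" for up
    using that worst_case_confounder_iff[OF \<gamma>\<delta>] by blast
  then show "?f up = Max (class_null_dist N I n \<gamma> \<delta> c T r ` candidate_set N J r)"
    if "worst_case_confounder N I n \<gamma> \<delta> c T r up" for up
    using that by (simp add: class_null_dist_image[OF r])
  show "?f u = ?f u'" if "(u, u') \<in> confounder_equiv N J r" for u u'
    using that r by (rule null_dist_cong_equiv)
  show "class_null_dist N I n \<gamma> \<delta> c T r C = ?f u'" if "C \<in> candidate_set N J r" "u' \<in> C" for C u'
    using that r by (rule class_null_dist_eq)
  show "card (candidate_set N J r) \<le> N ^ J" if "J \<ge> 2"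
  proof -
    \<comment> \<open>Since \<open>\<delta>\<close> is not constant there are two treatment levels,
      each with at least one subject; hence \<open>N \<ge> 2\<close>.\<close>
    obtain i i' where i: "i \<in> {1..I}" "i' \<in> {1..I}" "i \<noteq> i'" using assms(5) by blast
    have "n i + n i' = (\<Sum>k\<in>{i, i'}. n k)" using i by simp
    also have "\<dots> \<le> N" unfolding assms(2)[symmetric] using i by (intro sum_mono2) auto
    finally have "N \<ge> 2" using bspec[OF assms(1) i(1)] bspec[OF assms(1) i(2)] by linarith
    moreover have "(\<Sum>j\<in>{1..J}. card {s \<in> {1..N}. r s = j}) = N"
      using sum.group[of "{1..N}" "{1..J}" r "\<lambda>_. 1 :: nat"] r
      by (simp add: PiE_iff image_subset_iff)
    ultimately show ?thesis
      using card_candidate_set_le[OF r] prod_Suc_le_power[of _ J N] that order_trans by blast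
  qed
qed

end
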